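(* Let $n\ge 5$ and $4\le m\le\binom n2$ be integers. Then: (i) if $4\le m\le n+1$, then $D(n,1,m)=n-3$; (ii) if $n+2\le m\le\binom{n-1}{2}$ and $r$ is a positive integer with $r\le n$ such that $\binom{n-(r+1)}{2}+(n-2)<m\le\binom{n-r}{2}+(n-2)$, then $D(n,1,m)=r$; (iii) if $m>\binom{n-1}{2}$, then $D(n,1,m)=0$.
   Context: All graphs are finite and simple. For a vertex $u$ of a graph $G$, $N[u]$ is its closed neighborhood (the set consisting of $u$ and all vertices adjacent to $u$). A set $S\subseteq V(G)$ is dominating if every vertex of $G$ lies in $N[s]$ for some $s\in S$. A vertex $u\in V(G)$ is overdominated by $S$ if $|N[u]\cap S|\ge 2$. The cardinality-redundance $CR(S)$ is the number of vertices of $G$ overdominated by $S$, and $CR(G)$ is the minimum of $CR(S)$ over all dominating sets $S$ of $G$. $\gamma_{CR}(G)$ is the minimum size of a dominating set $S$ with $CR(S)=CR(G)$. For integers $n\ge 1$, $0\le k\le n$ and $0\le m\le\binom n2$, $D(n,k,m)$ is the maximum of $\gamma_{CR}(G)$ over all graphs $G$ with $n$ vertices, $m$ edges and $CR(G)=k$; if no such graph exists, $D(n,k,m)=0$. *)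

theory Defs
  imports Main
begin

definition simple_graph :: "'a set \<Rightarrow> 'a set set \<Rightarrow> bool" where
  "simple_graph V E \<longleftrightarrow> finite V \<and> (\<forall>e\<in>E. e \<subseteq> V \<and> card e = 2)"

definition closed_nbhd :: "'a set \<Rightarrow> 'a set set \<Rightarrow> 'a \<Rightarrow> 'a set" where
  "closed_nbhd V E u = insert u {v \<in> V. {u, v} \<in> E}"

definition dominating :: "'a set \<Rightarrow> 'a set set \<Rightarrow> 'a set \<Rightarrow> bool" where
  "dominating V E S \<longleftrightarrow> S \<subseteq> V \<and> (\<forall>v\<in>V. \<exists>s\<in>S. v \<in> closed_nbhd V E s)"

definition overdominated :: "'a set \<Rightarrow> 'a set set \<Rightarrow> 'a set \<Rightarrow> 'a \<Rightarrow> bool" where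
  "overdominated V E S u \<longleftrightarrow> card (closed_nbhd V E u \<inter> S) \<ge> 2"

definition CR_set :: "'a set \<Rightarrow> 'a set set \<Rightarrow> 'a set \<Rightarrow> nat" where
  "CR_set V E S = card {u \<in> V. overdominated V E S u}"

definition CR :: "'a set \<Rightarrow> 'a set set \<Rightarrow> nat" where
  "CR V E = Min {CR_set V E S | S. dominating V E S}"

definition gamma_CR :: "'a set \<Rightarrow> 'a set set \<Rightarrow> nat" where
  "gamma_CR V E = Min {card S | S. dominating V E S \<and> CR_set V E S = CR V E}"

text \<open>
  Since \<^const>\<open>gamma_CR\<close> is invariant under graph isomorphism, it suffices to let the vertices be
  natural numbers; the set of values below is then finite, being bounded by the order of the graph.
\<close>

definition gamma_CR_values :: "nat \<Rightarrow> nat \<Rightarrow> nat \<Rightarrow> nat set" where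
  "gamma_CR_values n k m =
     {gamma_CR V E | (V :: nat set) E.
        simple_graph V E \<and> card V = n \<and> card E = m \<and> CR V E = k}"

definition D :: "nat \<Rightarrow> nat \<Rightarrow> nat \<Rightarrow> nat" where
  "D n k m = (if gamma_CR_values n k m = {} then 0 else Max (gamma_CR_values n k m))"

end

theory Submission
  imports Defs
begin

text \<open>
  Let \<open>S\<close> be a dominating set of size \<open>r\<close> with exactly one overdominated vertex \<open>x\<close>. Two adjacent
  members of \<open>S\<close> would both be overdominated, and if \<open>x\<close> were in \<open>S\<close>, so would be a second member
  of \<open>S\<close> covering it. Hence \<open>S\<close> is independent, \<open>x\<close> lies outside \<open>S\<close> and has \<open>d \<ge> 2\<close> neighbours
  in \<open>S\<close>, and every other vertex outside \<open>S\<close> has exactly one neighbour in \<open>S\<close>. Counting edges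
  inside the complement of \<open>S\<close> and edges between the complement and \<open>S\<close> gives
  \<open>m \<le> (n - r choose 2) + (n - r - 1) + d\<close> with \<open>d \<le> r\<close>. If both \<open>d = r\<close> and the complement is
  a clique, then \<open>x\<close> is adjacent to all other vertices, so the singleton of \<open>x\<close> dominates without
  overdominating and the cardinality-redundance is 0. When it is 1, therefore
  \<open>m \<le> (n - r choose 2) + (n - 2)\<close> (\<open>card_edges_less\<close>). Since \<open>r \<ge> d \<ge> 2\<close>, no graph with more than
  \<open>n - 1 choose 2\<close> edges has cardinality-redundance 1, and for fewer edges the inequality bounds
  \<open>r\<close> from above.

  For fewer than \<open>n\<close> edges that bound is too weak. Instead, when \<open>S\<close> has minimum size, exchange the
  neighbours of \<open>x\<close> in \<open>S\<close> for \<open>x\<close>. If at most one vertex \<open>y \<noteq> x\<close> lies outside \<open>S\<close>, then this exchange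
  yields a perfect dominating set (one covering each vertex exactly once), or a smaller
  dominating set with one overdominated vertex, or a set missing only \<open>y\<close>; in the last case all edges are at \<open>x\<close> or \<open>y\<close>, so \<open>m \<ge> 4\<close> forces
  \<open>d \<ge> 3\<close>, and adding \<open>y\<close> still gives a smaller set. Hence \<open>r \<le> n - 3\<close> for \<open>m \<ge> 4\<close>
  (\<open>card_add_three_le\<close>).

  Both bounds are attained. The graph consists of an independent set \<open>S\<close> of size \<open>r\<close>, a clique
  \<open>Y\<close> each of whose vertices has one neighbour in \<open>S\<close>, and a hub \<open>x\<close> adjacent to at least
  two vertices of \<open>S\<close> and to a proper, possibly empty, subset of \<open>Y\<close> (\<open>hub_graph\<close>). Varying the
  neighbourhood of the hub gives all required numbers of edges except \<open>m = 4\<close>, where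
  a tree with isolated vertices is used (\<open>spider_value\<close>).
\<close>

section \<open>Covering, redundance and minimum sets\<close>

text \<open>The reflexive closure of adjacency: membership in a closed neighbourhood.\<close>

definition covers :: "'a set set \<Rightarrow> 'a \<Rightarrow> 'a \<Rightarrow> bool" where
  "covers E u v \<longleftrightarrow> u = v \<or> {u, v} \<in> E"

lemma covers_refl [simp]: "covers E u u"
  by (simp add: covers_def)

lemma covers_sym: "covers E u v \<Longrightarrow> covers E v u"
  by (auto simp: covers_def insert_commute)

lemma dominating_iff_covers:
  "dominating V E S \<longleftrightarrow> S \<subseteq> V \<and> (\<forall>v\<in>V. \<exists>s\<in>S. covers E v s)"
proof -
  have "v \<in> closed_nbhd V E s \<longleftrightarrow> covers E v s" if "v \<in> V" for v s
    using that by (auto simp: closed_nbhd_def covers_def insert_commute)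
  then show ?thesis
    unfolding dominating_def by blast
qed

lemma dominating_subset: "dominating V E S \<Longrightarrow> S \<subseteq> V"
  by (simp add: dominating_def)

lemma overdominated_iff_covers:
  assumes "finite V" "S \<subseteq> V"
  shows "overdominated V E S u \<longleftrightarrow>
    (\<exists>a\<in>S. \<exists>b\<in>S. a \<noteq> b \<and> covers E u a \<and> covers E u b)"
proof -
  have eq: "closed_nbhd V E u \<inter> S = {s \<in> S. covers E u s}"
    using assms(2) by (auto simp: closed_nbhd_def covers_def)
  have "finite {s \<in> S. covers E u s}"
    using assms finite_subset by fastforce
  then have "2 \<le> card {s \<in> S. covers E u s} \<longleftrightarrow>
    (\<exists>a\<in>{s \<in> S. covers E u s}. \<exists>b\<in>{s \<in> S. covers E u s}. a \<noteq> b)"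
    using card_le_Suc0_iff_eq[of "{s \<in> S. covers E u s}"] by (simp add: not_less_eq_eq[symmetric] numeral_2_eq_2)
  then show ?thesis
    unfolding overdominated_def eq by blast
qed

lemma two_le_CR_set:
  assumes "finite V" "S \<subseteq> V" "u \<in> V" "v \<in> V" "u \<noteq> v"
    and "overdominated V E S u" "overdominated V E S v"
  shows "2 \<le> CR_set V E S"
proof -
  have "card {u, v} \<le> card {w \<in> V. overdominated V E S w}"
    using assms by (intro card_mono) auto
  then show ?thesis
    using assms(5) by (simp add: CR_set_def)
qed

lemma one_le_CR_set:
  assumes "finite V" "u \<in> V" "overdominated V E S u"
  shows "1 \<le> CR_set V E S"
  using assms by (auto simp: CR_set_def Suc_le_eq card_gt_0_iff)

lemma finite_dominating_image:
  assumes "finite V"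
  shows "finite {g S |S. dominating V E S \<and> P S}"
proof -
  have "{g S |S. dominating V E S \<and> P S} \<subseteq> g ` Pow V"
    by (auto simp: dominating_def)
  then show ?thesis
    using assms finite_subset by blast
qed

lemma dominating_all: "dominating V E V"
  unfolding dominating_iff_covers by (meson covers_refl order_refl)

lemma CR_le:
  assumes "finite V" "dominating V E S"
  shows "CR V E \<le> CR_set V E S"
  unfolding CR_def using assms finite_dominating_image[of V "CR_set V E" E "\<lambda>_. True"]
  by (intro Min_le) auto

lemma CR_attained:
  assumes "finite V"
  obtains S where "dominating V E S" "CR_set V E S = CR V E"
proof -
  have "CR V E \<in> {CR_set V E S | S. dominating V E S}"
    unfolding CR_def
    using assms finite_dominating_image[of V "CR_set V E" E "\<lambda>_. True"] dominating_all
    by (intro Min_in) auto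
  then show thesis using that by auto
qed

lemma gamma_CR_attained:
  assumes "finite V"
  obtains S where "dominating V E S" "CR_set V E S = CR V E" "card S = gamma_CR V E"
proof -
  obtain S0 where "dominating V E S0" "CR_set V E S0 = CR V E"
    using CR_attained assms by blast
  then have "gamma_CR V E \<in> {card S | S. dominating V E S \<and> CR_set V E S = CR V E}"
    unfolding gamma_CR_def using assms
    by (intro Min_in finite_dominating_image) auto
  then show thesis using that by auto
qed

lemma gamma_CR_le:
  assumes "finite V" "dominating V E S" "CR_set V E S = CR V E"
  shows "gamma_CR V E \<le> card S"
  unfolding gamma_CR_def using assms
  by (intro Min_le finite_dominating_image) auto

text \<open>
  The bound on \<open>T\<close> excludes perfect dominating sets and, at the same time, smaller dominating
  sets with a single overdominated vertex.
\<close>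

lemma CR_one_gamma_CR_eqI:
  assumes "finite V" "dominating V E S" "CR_set V E S = 1"
    and bound: "\<And>T. dominating V E T \<Longrightarrow>
      2 \<le> CR_set V E T \<or> 1 \<le> CR_set V E T \<and> card S \<le> card T"
  shows "CR V E = 1" "gamma_CR V E = card S"
proof -
  obtain T where T: "dominating V E T" "CR_set V E T = CR V E" "card T = gamma_CR V E"
    using gamma_CR_attained assms(1) by blast
  have "CR V E \<le> 1"
    using CR_le[OF assms(1,2)] assms(3) by simp
  then show one: "CR V E = 1"
    using bound[OF T(1)] T(2) by auto
  have "card S \<le> gamma_CR V E"
    using bound[OF T(1)] T(2,3) one by auto
  moreover have "gamma_CR V E \<le> card S"
    using gamma_CR_le[OF assms(1,2)] assms(3) one by simp
  ultimately show "gamma_CR V E = card S" by simp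
qed

lemma finite_gamma_CR_values: "n \<ge> 1 \<Longrightarrow> finite (gamma_CR_values n k m)"
proof (rule finite_subset)
  assume "n \<ge> 1"
  show "gamma_CR_values n k m \<subseteq> {..n}"
  proof
    fix g assume "g \<in> gamma_CR_values n k m"
    then obtain V :: "nat set" and E where V: "g = gamma_CR V E" "simple_graph V E" "card V = n"
      unfolding gamma_CR_values_def by blast
    then have fin: "finite V" by (simp add: simple_graph_def)
    obtain S where "dominating V E S" "card S = gamma_CR V E"
      using gamma_CR_attained[OF fin] by blast
    then show "g \<in> {..n}"
      using V card_mono[OF fin dominating_subset] by fastforce
  qed
qed simp

lemma D_eqI:
  assumes "n \<ge> 1" "r \<in> gamma_CR_values n k m" "\<And>g. g \<in> gamma_CR_values n k m \<Longrightarrow> g \<le> r"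
  shows "D n k m = r"
  using assms finite_gamma_CR_values[of n k m] unfolding D_def
  by (auto intro!: Max_eqI)

text \<open>A perfect dominating set, covering each vertex exactly once, makes the redundance vanish.\<close>

lemma CR_eq_zeroI:
  assumes "finite V" "T \<subseteq> V" "\<And>v. v \<in> V \<Longrightarrow> \<exists>!t. t \<in> T \<and> covers E v t"
  shows "CR V E = 0"
proof -
  have "dominating V E T"
    unfolding dominating_iff_covers using assms(2,3) by blast
  moreover have "{u \<in> V. overdominated V E T u} = {}"
    using assms(3) overdominated_iff_covers[OF assms(1,2)] by blast
  then have "CR_set V E T = 0"
    unfolding CR_set_def by (metis card.empty)
  ultimately show ?thesis
    using CR_le[OF assms(1)] by (metis le_zero_eq)
qed

text \<open>
  If the redundance is 1, it suffices that a single vertex \<open>w\<close> may be overdominated: it must then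
  actually be so.
\<close>

lemma gamma_CR_leI:
  assumes "finite V" "CR V E = 1" "dominating V E T"
    and unique: "\<And>v a b. v \<in> V \<Longrightarrow> v \<noteq> w \<Longrightarrow> a \<in> T \<Longrightarrow> b \<in> T \<Longrightarrow>
      covers E v a \<Longrightarrow> covers E v b \<Longrightarrow> a = b"
  shows "gamma_CR V E \<le> card T"
proof -
  have "{u \<in> V. overdominated V E T u} \<subseteq> {w}"
    using unique overdominated_iff_covers[OF assms(1) dominating_subset[OF assms(3)]] by blast
  from card_mono[OF _ this] have "CR_set V E T \<le> 1"
    by (simp add: CR_set_def)
  then show ?thesis
    using CR_le[OF assms(1,3)] assms(2) by (intro gamma_CR_le assms) simp
qed

section \<open>Dominating sets with a single overdominated vertex\<close>

text \<open>A graph with a dominating set \<open>S\<close> whose only overdominated vertex is \<open>x\<close>.\<close>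

locale one_overdominated =
  fixes V :: "'a set" and E S x
  assumes graph: "simple_graph V E"
    and dom: "dominating V E S"
    and over: "{u \<in> V. overdominated V E S u} = {x}"
begin

lemma finV: "finite V" and edges: "e \<in> E \<Longrightarrow> e \<subseteq> V \<and> card e = 2"
  using graph by (auto simp: simple_graph_def)

lemma SV: "S \<subseteq> V" and finS: "finite S"
  using dom finV finite_subset by (auto simp: dominating_def)

lemma xV: "x \<in> V"
  using over by auto

lemma unique_cover:
  assumes "v \<in> V" "v \<noteq> x" "s \<in> S" "t \<in> S" "covers E v s" "covers E v t"
  shows "s = t"
proof (rule ccontr)
  assume "s \<noteq> t"
  then have "v \<in> {u \<in> V. overdominated V E S u}"
    using assms overdominated_iff_covers[OF finV SV] by blast
  then show False
    using over assms(2) by auto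
qed

lemma x_covered_twice: "\<exists>a\<in>S. \<exists>b\<in>S. a \<noteq> b \<and> covers E x a \<and> covers E x b"
  using over overdominated_iff_covers[OF finV SV, of E x] by blast

lemma x_notin: "x \<notin> S"
proof
  assume "x \<in> S"
  obtain a where "a \<in> S" "a \<noteq> x" "covers E x a"
    using x_covered_twice by metis
  then show False
    using unique_cover[of a a x] SV \<open>x \<in> S\<close> covers_sym by (metis covers_refl subsetD)
qed

lemma independent: "s \<in> S \<Longrightarrow> t \<in> S \<Longrightarrow> covers E s t \<longleftrightarrow> s = t"
  using unique_cover[of s s t] SV x_notin by (metis covers_refl subsetD)

text \<open>The neighbours of \<open>x\<close> in \<open>S\<close>; since \<open>x\<close> is not in \<open>S\<close>, covering means adjacency here.\<close>

definition "nbrs = {s \<in> S. covers E x s}"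
text \<open>
  The unique member of \<open>S\<close> covering \<open>v\<close>; it exists for every vertex \<open>v\<close> other than \<open>x\<close>, and is \<open>v\<close>
  itself if \<open>v\<close> is in \<open>S\<close>.
\<close>

definition "guard v = (THE s. s \<in> S \<and> covers E v s)"

lemma guard:
  assumes "v \<in> V" "v \<noteq> x"
  shows "guard v \<in> S" "covers E v (guard v)"
proof -
  have "\<exists>!s. s \<in> S \<and> covers E v s"
    using dom assms unique_cover by (metis dominating_iff_covers)
  from theI'[OF this] show "guard v \<in> S" "covers E v (guard v)"
    by (auto simp: guard_def)
qed

lemma guard_unique: "v \<in> V \<Longrightarrow> v \<noteq> x \<Longrightarrow> s \<in> S \<Longrightarrow> covers E v s \<longleftrightarrow> s = guard v"
  using guard unique_cover by metis

lemma nbrs_subset: "nbrs \<subseteq> S" and fin_nbrs: "finite nbrs"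
  using finS by (auto simp: nbrs_def)

lemma two_le_card_nbrs: "2 \<le> card nbrs"
proof -
  obtain a b where "a \<in> S" "b \<in> S" "a \<noteq> b" "covers E x a" "covers E x b"
    using x_covered_twice by blast
  then have "card {a, b} \<le> card nbrs"
    by (intro card_mono fin_nbrs) (auto simp: nbrs_def)
  then show ?thesis using \<open>a \<noteq> b\<close> by simp
qed

text \<open>
  Every edge lies outside \<open>S\<close>, or joins \<open>x\<close> to a neighbour in \<open>S\<close>, or joins another vertex outside
  \<open>S\<close> to its guard.
\<close>

lemma card_edges_le:
  "card E \<le> card {e \<in> E. e \<subseteq> V - S} + card nbrs + (card V - card S - 1)"
proof -
  let ?W = "V - S - {x}"
  let ?F = "{e \<in> E. e \<subseteq> V - S}"
  have "E \<subseteq> ?F \<union> (\<lambda>s. {x, s}) ` nbrs \<union> (\<lambda>v. {v, guard v}) ` ?W"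
  proof
    fix e assume e: "e \<in> E"
    then have "e \<subseteq> V" "card e = 2" using edges by auto
    then obtain u v where uv: "e = {u, v}" "u \<noteq> v" "u \<in> V" "v \<in> V"
      by (auto simp: card_2_iff)
    have *: "{a, b} \<in> (\<lambda>s. {x, s}) ` nbrs \<union> (\<lambda>v. {v, guard v}) ` ?W"
      if "{a, b} \<in> E" "a \<noteq> b" "a \<in> V" "b \<in> S" for a b
    proof -
      have c: "covers E a b" using that by (simp add: covers_def)
      then have "a \<notin> S" using independent that by blast
      show ?thesis
      proof (cases "a = x")
        case True
        then show ?thesis using c that by (auto simp: nbrs_def)
      next
        case False
        then have "b = guard a" using guard_unique that c by blast
        then show ?thesis using False \<open>a \<notin> S\<close> that by blast
      qed
    qed
    show "e \<in> ?F \<union> (\<lambda>s. {x, s}) ` nbrs \<union> (\<lambda>v. {v, guard v}) ` ?W"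
      using *[of u v] *[of v u] e uv by (auto simp: insert_commute)
  qed
  moreover have finE: "finite ?F"
    by (rule finite_subset[of _ "Pow V"]) (use finV in auto)
  ultimately have "card E \<le> card (?F \<union> (\<lambda>s. {x, s}) ` nbrs \<union> (\<lambda>v. {v, guard v}) ` ?W)"
    using finV fin_nbrs by (intro card_mono) auto
  also have "\<dots> \<le> card ?F + card nbrs + card ?W"
    using card_Un_le[of "?F \<union> (\<lambda>s. {x, s}) ` nbrs" "(\<lambda>v. {v, guard v}) ` ?W"]
      card_Un_le[of ?F "(\<lambda>s. {x, s}) ` nbrs"]
      card_image_le[OF fin_nbrs, of "\<lambda>s. {x, s}"]
      card_image_le[of ?W "\<lambda>v. {v, guard v}"] finV by fastforce
  also have "card ?W = card V - card S - 1"
    using finV finS SV xV x_notin by (simp add: card_Diff_subset)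
  finally show ?thesis .
qed

lemma card_S_less: "card S < card V"
  using finV SV xV x_notin by (intro psubset_card_mono) auto

text \<open>
  In the preceding count one edge more would need all of \<open>S\<close> adjacent to \<open>x\<close> and a complete graph
  outside \<open>S\<close>; but then \<open>x\<close> is adjacent to every other vertex and dominates perfectly on its own.
\<close>

lemma card_edges_less:
  assumes "CR V E \<noteq> 0"
  shows "card E \<le> ((card V - card S) choose 2) + (card V - 2)"
proof -
  let ?W = "V - S" and ?F = "{e \<in> E. e \<subseteq> V - S}"
  let ?P = "{e. e \<subseteq> V - S \<and> card e = 2}"
  have finW: "finite ?W" and cardW: "card ?W = card V - card S"
    using finV finS SV by (auto simp: card_Diff_subset)
  have finP: "finite ?P"
    by (rule finite_subset[of _ "Pow V"]) (use finV in auto)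
  have cardP: "card ?P = (card V - card S) choose 2"
    using n_subsets[OF finW, of 2] cardW by simp
  have FP: "?F \<subseteq> ?P" using edges by auto
  have "\<not> (nbrs = S \<and> ?F = ?P)"
  proof
    assume *: "nbrs = S \<and> ?F = ?P"
    have "covers E v x" if "v \<in> V" for v
    proof (cases "v \<in> S \<or> v = x")
      case True
      then show ?thesis using * covers_sym by (fastforce simp: nbrs_def)
    next
      case False
      then have "{v, x} \<in> ?P" using that xV x_notin by auto
      then show ?thesis using * by (auto simp: covers_def)
    qed
    then have d: "dominating V E {x}"
      using xV by (auto simp: dominating_iff_covers)
    have "CR_set V E {x} = 0"
      using overdominated_iff_covers[OF finV, of "{x}"] xV by (simp add: CR_set_def)
    then show False using CR_le[OF finV d] assms by simp
  qed
  then have "card nbrs < card S \<or> card ?F < card ?P"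
    using nbrs_subset FP finS finP psubset_card_mono by (metis (no_types, lifting) psubsetI)
  moreover have "card nbrs \<le> card S" "card ?F \<le> card ?P"
    using card_mono[OF finS nbrs_subset] card_mono[OF finP FP] .
  ultimately show ?thesis
    using card_edges_le card_S_less two_le_card_nbrs cardP by linarith
qed

lemma two_le_card: "2 \<le> card S"
  using two_le_card_nbrs card_mono[OF finS nbrs_subset] by simp

text \<open>
  If there are at least four edges, at least three vertices lie outside a minimum \<open>S\<close>.
  Otherwise the exchanged set \<open>T = {x} \<union> (S - nbrs)\<close>, which covers \<open>x\<close> and the vertices of \<open>S\<close> exactly once, leads to a
  contradiction according to how often it covers the at most one remaining vertex \<open>y\<close>.
\<close>

lemma card_add_three_le:
  assumes CR: "CR V E = 1" and min: "gamma_CR V E = card S" and "4 \<le> card E"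
  shows "card S + 3 \<le> card V"
proof (rule ccontr)
  assume small: "\<not> ?thesis"
  define T where "T = insert x (S - nbrs)"
  have TV: "T \<subseteq> V" using xV SV by (auto simp: T_def)
  have cardT: "card T = card S - card nbrs + 1"
    using x_notin finS by (simp add: T_def card_Diff_subset fin_nbrs nbrs_subset)
  have le: "card nbrs \<le> card S"
    by (rule card_mono[OF finS nbrs_subset])
  have cx: "covers E x t \<longleftrightarrow> t = x" if "t \<in> T" for t
    using that by (auto simp: T_def nbrs_def)
  have cs: "covers E s t \<longleftrightarrow> t = (if s \<in> nbrs then x else s)" if "s \<in> S" "t \<in> T" for s t
    using that independent x_notin covers_sym[of E s x] covers_sym[of E x s]
    by (auto simp: T_def nbrs_def)
  have unique: "\<exists>!t. t \<in> T \<and> covers E v t" if "v = x \<or> v \<in> S" for v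
  proof (rule ex1I[of _ "if v \<in> S \<and> v \<notin> nbrs then v else x"])
    show "(if v \<in> S \<and> v \<notin> nbrs then v else x) \<in> T \<and>
        covers E v (if v \<in> S \<and> v \<notin> nbrs then v else x)"
      using that cs[of v x] x_notin by (auto simp: T_def)
  next
    fix t assume "t \<in> T \<and> covers E v t"
    then show "t = (if v \<in> S \<and> v \<notin> nbrs then v else x)"
      using that cs[of v t] cx[of t] x_notin by (auto split: if_splits)
  qed
  have "\<not> V \<subseteq> insert x S"
    using CR_eq_zeroI[OF finV TV] unique CR by (metis insert_iff subsetD zero_neq_one)
  then obtain y where y: "y \<in> V" "y \<noteq> x" "y \<notin> S" by blast
  have V_eq: "V = insert y (insert x S)"
  proof (rule card_seteq[symmetric])
    show "card V \<le> card (insert y (insert x S))"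
      using y x_notin finS small by simp
  qed (use finV y xV SV in auto)
  have gS: "guard y \<in> S" using guard y by blast
  have cy: "covers E y t \<longleftrightarrow> t = x \<and> covers E y x \<or> t = guard y \<and> guard y \<notin> nbrs"
    if "t \<in> T" for t
    using that guard_unique[of y] y gS x_notin by (auto simp: T_def)
  have xT: "x \<in> T" by (simp add: T_def)
  consider (one) "covers E y x \<longleftrightarrow> guard y \<in> nbrs"
    | (both) "covers E y x" "guard y \<notin> nbrs"
    | (none) "\<not> covers E y x" "guard y \<in> nbrs" by blast
  then show False
  proof cases
    case one
    have "\<exists>!t. t \<in> T \<and> covers E y t"
    proof (rule ex1I[of _ "if covers E y x then x else guard y"])
      show "(if covers E y x then x else guard y) \<in> T \<and>
          covers E y (if covers E y x then x else guard y)"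
        using one gS guard y xT by (auto simp: T_def)
    next
      fix t assume "t \<in> T \<and> covers E y t"
      then show "t = (if covers E y x then x else guard y)"
        using one cy[of t] by auto
    qed
    then have "CR V E = 0"
      using CR_eq_zeroI[OF finV TV] unique V_eq by (metis insert_iff)
    then show False using CR by simp
  next
    case both
    have "dominating V E T"
      unfolding dominating_iff_covers using TV unique V_eq both xT by (metis insert_iff)
    then have "gamma_CR V E \<le> card T"
      using unique V_eq by (intro gamma_CR_leI[OF finV CR, of T y]) auto
    then show False using cardT min two_le_card_nbrs le by linarith
  next
    case none
    \<comment> \<open>\<open>T\<close> misses \<open>y\<close>; adding \<open>y\<close> overdominates only its guard. As \<open>x\<close> and \<open>y\<close> are not adjacent,
      there are at most \<open>card nbrs + 1\<close> edges, so the enlarged set is still smaller than \<open>S\<close>.\<close>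
    let ?T = "insert y T"
    have "{e \<in> E. e \<subseteq> V - S} = {}"
    proof (intro equals0I)
      fix e assume "e \<in> {e \<in> E. e \<subseteq> V - S}"
      then have e: "e \<in> E" "e \<subseteq> {y, x}" "card e = 2"
        using edges V_eq by auto
      then have "e = {y, x}"
        using y by (intro card_subset_eq) auto
      then show False using none e by (simp add: covers_def)
    qed
    then have "card E \<le> card nbrs + (card V - card S - 1)"
      using card_edges_le by (metis add_0 card.empty)
    then have d: "3 \<le> card nbrs"
      using assms(3) small by linarith
    have sy: "covers E s y \<longleftrightarrow> s = guard y" if "s \<in> S" for s
      using guard_unique[of y s] y that covers_sym by metis
    have xy: "\<not> covers E x y" using none covers_sym by metis
    have yt: "\<not> covers E y t" if "t \<in> T" for t
      using none cy that by blast
    have "dominating V E ?T"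
      unfolding dominating_iff_covers
      using TV y unique V_eq by (metis covers_refl insert_iff insert_subset)
    then have "gamma_CR V E \<le> card ?T"
      using unique V_eq sy xy yt by (intro gamma_CR_leI[OF finV CR, of ?T "guard y"]) auto
    also have "card ?T \<le> card T + 1"
      by (simp add: card_insert_le_m1 card_insert_if finite_subset[OF TV finV])
    finally show False using cardT min d le by linarith
  qed
qed

end

lemma CR_one_obtains_one_overdominated:
  assumes "simple_graph V E" "CR V E = 1"
  obtains S x where "one_overdominated V E S x" "card S = gamma_CR V E"
proof -
  have fin: "finite V" using assms by (simp add: simple_graph_def)
  obtain S where S: "dominating V E S" "CR_set V E S = CR V E" "card S = gamma_CR V E"
    using gamma_CR_attained[OF fin] by blast
  then obtain x where "{u \<in> V. overdominated V E S u} = {x}"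
    using assms(2) unfolding CR_set_def by (metis card_1_singletonE)
  then show thesis
    using that[of S x] S assms(1) by (simp add: one_overdominated_def)
qed

text \<open>The consequences for graphs of order \<open>n\<close> and size \<open>m\<close> with redundance 1.\<close>

lemma gamma_CR_valueD:
  assumes "g \<in> gamma_CR_values n 1 m"
  shows "2 \<le> g" "m \<le> ((n - g) choose 2) + (n - 2)" "4 \<le> m \<Longrightarrow> g \<le> n - 3"
proof -
  obtain V :: "nat set" and E where V: "g = gamma_CR V E" "simple_graph V E" "card V = n"
      "card E = m" "CR V E = 1"
    using assms unfolding gamma_CR_values_def by blast
  obtain S x where "one_overdominated V E S x" and g: "card S = gamma_CR V E"
    using CR_one_obtains_one_overdominated V by blast
  then interpret one_overdominated V E S x by simp
  show "2 \<le> g" "m \<le> ((n - g) choose 2) + (n - 2)"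
    using two_le_card card_edges_less V g by auto
  show "g \<le> n - 3" if "4 \<le> m"
    using card_add_three_le that V g by auto
qed

section \<open>Extremal graphs\<close>

text \<open>
  The hub \<open>x\<close> is adjacent to \<open>A \<subseteq> S\<close> and to \<open>B \<subset> Y\<close>; vertices of \<open>S\<close> outside \<open>A\<close> are isolated. The
  clique vertex \<open>y1\<close> is attached to \<open>s1\<close> and all other clique vertices to \<open>s2\<close>, so that no set
  consisting of one clique vertex and all but one vertex of \<open>S\<close> is perfect. If \<open>B\<close> is empty, the hub,
  one clique vertex and \<open>S - A\<close> form a dominating set with a single overdominated vertex, which is not
  smaller than \<open>S\<close> only if \<open>A\<close> has two elements.
\<close>

locale hub_graph =
  fixes S A Y B :: "'a set" and x s1 s2 y1
  assumes fin: "finite S" "finite Y"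
    and x: "x \<notin> S" "x \<notin> Y" and disj: "S \<inter> Y = {}"
    and A: "A \<subseteq> S" "s1 \<in> A" "s2 \<in> A" "s1 \<noteq> s2"
    and Y: "y1 \<in> Y" "2 \<le> card Y"
    and B: "B \<subset> Y" and B_empty: "B = {} \<Longrightarrow> A = {s1, s2}"
begin

text \<open>The vertex of \<open>S\<close> to which the clique vertex \<open>y\<close> is attached.\<close>

definition "att y = (if y = y1 then s1 else s2)"
text \<open>Vertices and edges of the graph. The edges form three disjoint families: at the hub, from the
  clique to \<open>S\<close>, and inside the clique.\<close>

definition "V = insert x (S \<union> Y)"
definition "E = (\<lambda>v. {x, v}) ` (A \<union> B) \<union> (\<lambda>y. {att y, y}) ` Y \<union> {e. e \<subseteq> Y \<and> card e = 2}"

lemma finV: "finite V"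
  using fin by (simp add: V_def)

lemma finAB: "finite A" "finite B"
  using A B fin finite_subset by blast+

lemma att: "att y \<in> A" "att y \<in> S"
  using A by (auto simp: att_def)

lemma att_notin: "att y \<noteq> x" "att y \<notin> Y" "y \<in> Y \<Longrightarrow> att y \<noteq> y"
  using att(2)[of y] x disj by auto

lemma simple: "simple_graph V E"
  using finV A B x disj att att_notin by (auto simp: simple_graph_def E_def V_def card_2_iff')

lemma card_V: "card V = card S + card Y + 1"
  using x disj fin by (simp add: V_def card_Un_disjoint)

lemma card_E: "card E = (card Y choose 2) + card Y + card A + card B"
proof -
  let ?X = "(\<lambda>v. {x, v}) ` (A \<union> B)" and ?Z = "(\<lambda>y. {att y, y}) ` Y"
  let ?P = "{e. e \<subseteq> Y \<and> card e = 2}"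
  have finP: "finite ?P" by (rule finite_subset[of _ "Pow Y"]) (use fin in auto)
  have "card ?X = card (A \<union> B)"
    using x by (intro card_image inj_onI) (auto simp: doubleton_eq_iff)
  also have "\<dots> = card A + card B"
    using A B disj by (intro card_Un_disjoint finAB) auto
  finally have X: "card ?X = card A + card B" .
  have Z: "card ?Z = card Y"
    using att_notin by (intro card_image inj_onI) (auto simp: doubleton_eq_iff)
  have "?X \<inter> ?Z = {}"
    using x att by (auto simp: doubleton_eq_iff)
  moreover have "(?X \<union> ?Z) \<inter> ?P = {}"
    using x att disj by auto
  ultimately have "card E = card ?X + card ?Z + card ?P"
    unfolding E_def using finAB fin finP by (simp add: card_Un_disjoint)
  then show ?thesis
    using X Z n_subsets[OF fin(2), of 2] by simp
qed

lemma covers_simps: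
  "s \<in> S \<Longrightarrow> covers E x s \<longleftrightarrow> s \<in> A"
  "y \<in> Y \<Longrightarrow> covers E x y \<longleftrightarrow> y \<in> B"
  "y \<in> Y \<Longrightarrow> z \<in> Y \<Longrightarrow> covers E y z"
  "y \<in> Y \<Longrightarrow> s \<in> S \<Longrightarrow> covers E y s \<longleftrightarrow> s = att y"
  "s \<in> S \<Longrightarrow> t \<in> S \<Longrightarrow> covers E s t \<longleftrightarrow> s = t"
proof -
  show "s \<in> S \<Longrightarrow> covers E x s \<longleftrightarrow> s \<in> A"
    using x disj B att_notin by (fastforce simp: covers_def E_def doubleton_eq_iff)
  show "y \<in> Y \<Longrightarrow> covers E x y \<longleftrightarrow> y \<in> B"
    using x disj A att_notin by (fastforce simp: covers_def E_def doubleton_eq_iff)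
  show "y \<in> Y \<Longrightarrow> z \<in> Y \<Longrightarrow> covers E y z"
    by (auto simp: covers_def E_def)
  show "y \<in> Y \<Longrightarrow> s \<in> S \<Longrightarrow> covers E y s \<longleftrightarrow> s = att y"
    using x disj att_notin by (fastforce simp: covers_def E_def doubleton_eq_iff)
  show "s \<in> S \<Longrightarrow> t \<in> S \<Longrightarrow> covers E s t \<longleftrightarrow> s = t"
    using x disj att_notin by (fastforce simp: covers_def E_def doubleton_eq_iff)
qed

lemma covers_flip_simps:
  "s \<in> S \<Longrightarrow> covers E s x \<longleftrightarrow> s \<in> A"
  "y \<in> Y \<Longrightarrow> covers E y x \<longleftrightarrow> y \<in> B"
  "y \<in> Y \<Longrightarrow> s \<in> S \<Longrightarrow> covers E s y \<longleftrightarrow> s = att y"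
  using covers_simps covers_sym by metis+

lemma overdominatedI:
  "dominating V E T \<Longrightarrow> a \<in> T \<Longrightarrow> b \<in> T \<Longrightarrow> a \<noteq> b \<Longrightarrow> covers E u a \<Longrightarrow> covers E u b \<Longrightarrow>
    overdominated V E T u"
  using overdominated_iff_covers[OF finV dominating_subset] by blast

lemma CR_set_ge_two:
  "dominating V E T \<Longrightarrow> u \<in> V \<Longrightarrow> v \<in> V \<Longrightarrow> u \<noteq> v \<Longrightarrow>
    overdominated V E T u \<Longrightarrow> overdominated V E T v \<Longrightarrow> 2 \<le> CR_set V E T"
  using two_le_CR_set[OF finV dominating_subset] by blast

lemma dominating_S: "dominating V E S"
  unfolding dominating_iff_covers
proof (intro conjI ballI)
  fix v assume "v \<in> V"
  then consider "v = x" | "v \<in> S" | "v \<in> Y" by (auto simp: V_def)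
  then show "\<exists>s\<in>S. covers E v s"
  proof cases
    case 1
    then show ?thesis using A covers_simps(1)[of s1] by blast
  next
    case 2
    then show ?thesis by (meson covers_refl)
  next
    case 3
    then show ?thesis using covers_simps(4) att by blast
  qed
qed (auto simp: V_def)

lemma CR_set_S: "CR_set V E S = 1"
proof -
  have "{u \<in> V. overdominated V E S u} = {x}"
  proof
    show "{x} \<subseteq> {u \<in> V. overdominated V E S u}"
      using overdominatedI[OF dominating_S, of s1 s2 x] A covers_simps(1) by (auto simp: V_def)
    show "{u \<in> V. overdominated V E S u} \<subseteq> {x}"
    proof
      fix u assume "u \<in> {u \<in> V. overdominated V E S u}"
      then obtain a b where "u \<in> V" "a \<in> S" "b \<in> S" "a \<noteq> b" "covers E u a" "covers E u b"
        using overdominated_iff_covers[OF finV dominating_subset[OF dominating_S]] by blast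
      then show "u \<in> {x}"
        using covers_simps(4,5) by (auto simp: V_def)
    qed
  qed
  then show ?thesis by (simp add: CR_set_def)
qed

text \<open>A vertex of \<open>S\<close> not in \<open>T\<close> has to be covered from the clique or from the hub.\<close>

lemma dominating_cases:
  assumes "dominating V E T" "s \<in> S" "s \<notin> T"
  shows "(\<exists>y\<in>T \<inter> Y. att y = s) \<or> x \<in> T \<and> s \<in> A"
proof -
  obtain t where "t \<in> T" "covers E s t"
    using assms(1,2) unfolding dominating_iff_covers V_def by blast
  moreover have "t \<in> V" using assms(1) \<open>t \<in> T\<close> dominating_subset by blast
  ultimately show ?thesis
    using assms(2,3) covers_simps covers_flip_simps by (auto simp: V_def)
qed

text \<open>
  If \<open>T\<close> contains the hub, some clique vertex \<open>y0\<close> outside \<open>B\<close> must be covered by another member \<open>t\<close>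
  of \<open>T\<close>. If \<open>t\<close> is in \<open>S\<close>, then \<open>x\<close> and \<open>t\<close> are overdominated; if \<open>t\<close> is in \<open>Y\<close>, then so are its attachment
  vertex and all of \<open>B\<close>. If \<open>B\<close> is empty, \<open>T\<close> is not smaller than \<open>S\<close>, since it contains \<open>x\<close>, \<open>t\<close> and
  the isolated vertices \<open>S - A\<close>, where \<open>A\<close> has only two elements.
\<close>

lemma CR_set_bound_hub:
  assumes T: "dominating V E T" and xT: "x \<in> T"
  shows "2 \<le> CR_set V E T \<or> 1 \<le> CR_set V E T \<and> card S \<le> card T"
proof -
  have in_V: "x \<in> V" "\<And>s. s \<in> S \<Longrightarrow> s \<in> V" "\<And>y. y \<in> Y \<Longrightarrow> y \<in> V"
    by (auto simp: V_def)
  have finT: "finite T"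
    using finite_subset[OF dominating_subset[OF T] finV] .
  obtain y0 where y0: "y0 \<in> Y" "y0 \<notin> B" using B by blast
  obtain t where t: "t \<in> T" "covers E y0 t" "t \<in> V"
    using T y0(1) in_V dominating_subset unfolding dominating_iff_covers by blast
  have "t \<noteq> x" using covers_flip_simps(2)[of y0] t y0 by blast
  then consider "t \<in> S" | "t \<in> Y" using t by (auto simp: V_def)
  then show ?thesis
  proof cases
    case 1
    then have t_att: "t = att y0" using covers_simps(4) t y0 by blast
    then have c: "covers E x t" "covers E t x"
      using covers_simps(1) covers_flip_simps(1) att by auto
    have "overdominated V E T x" "overdominated V E T t"
      using overdominatedI[OF T xT t(1) \<open>t \<noteq> x\<close>[symmetric]] c by auto
    then show ?thesis
      using CR_set_ge_two[OF T in_V(1) t(3)] \<open>t \<noteq> x\<close> by blast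
  next
    case 2
    have o: "overdominated V E T (att t)"
      using overdominatedI[OF T xT t(1) \<open>t \<noteq> x\<close>[symmetric]] 2
        covers_flip_simps(1)[of "att t"] covers_flip_simps(3)[of t "att t"] att by auto
    show ?thesis
    proof (cases "B = {}")
      case False
      then obtain b where b: "b \<in> B" "b \<in> Y" using B by blast
      then have "overdominated V E T b"
        using overdominatedI[OF T xT t(1) \<open>t \<noteq> x\<close>[symmetric]] 2
          covers_flip_simps(2)[of b] covers_simps(3)[of b t] by auto
      then show ?thesis
        using CR_set_ge_two[OF T _ _ _ o, of b] in_V b att att_notin by metis
    next
      case True
      then have A_eq: "A = {s1, s2}" using B_empty by blast
      have *: "S - A \<subseteq> T" using dominating_cases[OF T] att(1) by blast
      have "card S = card (S - A) + card {x, t}"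
        using A A_eq \<open>t \<noteq> x\<close> card_Diff_subset[of A S] card_mono[OF fin(1) A(1)] finAB by simp
      also have "\<dots> = card ((S - A) \<union> {x, t})"
        using x disj 2 fin by (intro card_Un_disjoint[symmetric]) auto
      also have "\<dots> \<le> card T"
        using * xT t finT by (intro card_mono) auto
      finally show ?thesis
        using one_le_CR_set[OF finV in_V(2)[OF att(2)] o] by blast
    qed
  qed
qed

text \<open>
  If \<open>T\<close> avoids the hub, then it equals \<open>S\<close>, or contains two clique vertices and overdominates the
  whole clique, or contains exactly one clique vertex \<open>z\<close>. In the last case it contains all of \<open>S\<close>
  except possibly the attachment vertex of \<open>z\<close>, and overdominates any clique vertex attached
  elsewhere.
\<close>

lemma CR_set_bound_no_hub:
  assumes T: "dominating V E T" and xT: "x \<notin> T"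
  shows "2 \<le> CR_set V E T \<or> 1 \<le> CR_set V E T \<and> card S \<le> card T"
proof -
  have YV: "y \<in> V" if "y \<in> Y" for y
    using that by (simp add: V_def)
  have finT: "finite T"
    using finite_subset[OF dominating_subset[OF T] finV] .
  obtain y2 where y2: "y2 \<in> Y" "y2 \<noteq> y1"
    using Y card_le_Suc0_iff_eq[OF fin(2)] by (metis not_less_eq_eq numeral_2_eq_2)
  consider "T \<inter> Y = {}" | z where "T \<inter> Y = {z}" | z z' where "z \<in> T \<inter> Y" "z' \<in> T \<inter> Y" "z \<noteq> z'"
    by blast
  then show ?thesis
  proof cases
    case 1
    then have "T = S"
      using dominating_cases[OF T] dominating_subset[OF T] xT by (auto simp: V_def)
    then show ?thesis using CR_set_S by simp
  next
    case (2 z)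
    then have z: "z \<in> T" "z \<in> Y" by auto
    have sub: "S - {att z} \<subseteq> T"
      using dominating_cases[OF T] 2 xT by auto
    have "card S = Suc (card (S - {att z}))"
      by (rule card.remove[OF fin(1) att(2)])
    also have "\<dots> = card (insert z (S - {att z}))"
      using z disj fin by (subst card_insert_disjoint) auto
    also have "\<dots> \<le> card T"
      using sub z finT by (intro card_mono) auto
    finally have card: "card S \<le> card T" .
    obtain w where w: "w \<in> Y" "att w \<noteq> att z"
      using Y(1) y2 A(4) unfolding att_def by metis
    have "att w \<in> T" using sub w att by blast
    then have "overdominated V E T w"
      using overdominatedI[OF T z(1), of "att w" w] covers_simps(3)[of w z]
        covers_simps(4)[of w "att w"] w z att att_notin by metis
    then show ?thesis
      using one_le_CR_set[OF finV YV[OF w(1)]] card by blast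
  next
    case (3 z z')
    have "overdominated V E T y" if "y \<in> Y" for y
      using overdominatedI[OF T, of z z' y] 3 that covers_simps(3) by blast
    then show ?thesis
      using CR_set_ge_two[OF T YV YV, of y1 y2] Y(1) y2 by metis
  qed
qed

lemma CR_eq_one: "CR V E = 1" and gamma_CR_eq: "gamma_CR V E = card S"
proof -
  have "2 \<le> CR_set V E T \<or> 1 \<le> CR_set V E T \<and> card S \<le> card T" if "dominating V E T" for T
    using that CR_set_bound_hub CR_set_bound_no_hub by (cases "x \<in> T") simp_all
  then show "CR V E = 1" "gamma_CR V E = card S"
    using CR_one_gamma_CR_eqI[OF finV dominating_S CR_set_S] by simp_all
qed

end

text \<open>Here \<open>a\<close> and \<open>p\<close> are the numbers of neighbours of the hub in \<open>S\<close> and in the clique.\<close>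

lemma hub_graph_value:
  assumes "2 \<le> q" "2 \<le> a" "a \<le> r" "p < q" "p = 0 \<Longrightarrow> a = 2"
  shows "r \<in> gamma_CR_values (r + q + 1) 1 ((q choose 2) + q + a + p)"
proof -
  interpret hub_graph "{1..r}" "{1..a}" "{r+1..r+q}" "{r+1..r+p}" 0 1 2 "r + 1"
    by unfold_locales (use assms in auto)
  show ?thesis
    unfolding gamma_CR_values_def
    using simple card_V card_E CR_eq_one gamma_CR_eq
    by (intro CollectI exI[of _ V] exI[of _ E]) auto
qed

text \<open>
  The case of four edges: the path \<open>2, 0, 1\<close> with two further leaves \<open>r + 1\<close>, \<open>r + 2\<close> at \<open>1\<close>, and the
  isolated vertices \<open>3, ..., r\<close>. The set \<open>{1..r}\<close> overdominates only \<open>0\<close>.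
\<close>

lemma spider_value:
  assumes "2 \<le> r"
  shows "r \<in> gamma_CR_values (r + 3) 1 4"
proof -
  let ?V = "{..<r + 3}" and ?S = "{1..r}"
  define E :: "nat set set" where "E = {{0, 1}, {0, 2}, {1, r + 1}, {1, r + 2}}"
  have covers: "covers E u v \<longleftrightarrow> u = v \<or> (u, v) \<in> {(0, 1), (1, 0), (0, 2), (2, 0), (1, r + 1),
      (r + 1, 1), (1, r + 2), (r + 2, 1)}" for u v
    unfolding covers_def E_def by (auto simp: doubleton_eq_iff)
  have SV: "?S \<subseteq> ?V" by auto
  have simple: "simple_graph ?V E"
    using assms by (auto simp: simple_graph_def E_def)
  have card_E: "card E = 4"
    using assms by (simp add: E_def card_insert_if doubleton_eq_iff)
  have over: "overdominated ?V E T u \<longleftrightarrow>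
      (\<exists>a\<in>T. \<exists>b\<in>T. a \<noteq> b \<and> covers E u a \<and> covers E u b)" if "T \<subseteq> ?V" for T u
    using overdominated_iff_covers[of ?V T] that by simp
  have overI: "overdominated ?V E T u"
    if "T \<subseteq> ?V" "a \<in> T" "b \<in> T" "a \<noteq> b" "covers E u a" "covers E u b" for T u a b
    using over that by blast
  have dom: "dominating ?V E ?S"
    unfolding dominating_iff_covers
  proof (intro conjI ballI)
    fix v assume "v \<in> ?V"
    then consider "v = 0" | "v \<in> ?S" | "v = r + 1" | "v = r + 2" by force
    then show "\<exists>s\<in>?S. covers E v s"
    proof cases
      case 2
      then show ?thesis by (meson covers_refl)
    qed (use assms in \<open>auto simp: covers intro!: bexI[of _ 1]\<close>)
  qed auto
  have "{u \<in> ?V. overdominated ?V E ?S u} = {0}"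
  proof
    show "{0} \<subseteq> {u \<in> ?V. overdominated ?V E ?S u}"
      using assms overI[OF SV, of 1 2 0] by (auto simp: covers)
    show "{u \<in> ?V. overdominated ?V E ?S u} \<subseteq> {0}"
    proof
      fix u assume "u \<in> {u \<in> ?V. overdominated ?V E ?S u}"
      then obtain a b where "a \<in> ?S" "b \<in> ?S" "a \<noteq> b" "covers E u a" "covers E u b"
        using over[OF SV] by blast
      then show "u \<in> {0}" unfolding covers by auto
    qed
  qed
  then have CR_set: "CR_set ?V E ?S = 1" by (simp add: CR_set_def)
  have bound: "2 \<le> CR_set ?V E T \<or> 1 \<le> CR_set ?V E T \<and> card ?S \<le> card T"
    if T: "dominating ?V E T" for T
  proof -
    have TV: "T \<subseteq> ?V" and finT: "finite T"
      using dominating_subset[OF T] finite_subset[OF dominating_subset[OF T]] by auto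
    have cov: "\<exists>t\<in>T. covers E v t" if "v \<in> ?V" for v
      using T that unfolding dominating_iff_covers by blast
    have rest: "{3..r} \<subseteq> T"
    proof
      fix v assume v: "v \<in> {3..r}"
      then obtain t where "t \<in> T" "covers E v t" using cov[of v] by auto
      then show "v \<in> T" using v unfolding covers by auto
    qed
    have cov2: "0 \<in> T \<or> 2 \<in> T"
      using cov[of 2] assms by (auto simp: covers)
    have leaf: "1 \<in> T \<or> r + 1 \<in> T" "1 \<in> T \<or> r + 2 \<in> T"
      using cov[of "r + 1"] cov[of "r + 2"] assms by (auto simp: covers)
    have large: "card ?S \<le> card T" if "insert a (insert b {3..r}) \<subseteq> T" "a \<noteq> b" "a \<notin> {3..r}" "b \<notin> {3..r}"
      for a b
      using card_mono[OF finT that(1)] that(2-) assms by simp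
    consider "1 \<in> T" "0 \<in> T" | "1 \<in> T" "2 \<in> T" | "1 \<notin> T" by (use cov2 in blast)
    then show ?thesis
    proof cases
      case 1
      then have "overdominated ?V E T 0" "overdominated ?V E T 1"
        using overI[OF TV, of 0 1] by (auto simp: covers)
      then show ?thesis
        using two_le_CR_set[of ?V T 0 1 E] TV by simp
    next
      case 2
      then have "overdominated ?V E T 0"
        using overI[OF TV, of 1 2] by (auto simp: covers)
      then show ?thesis
        using one_le_CR_set[of ?V 0 E T] large[of 1 2] 2 rest by simp
    next
      case 3
      then have "r + 1 \<in> T" "r + 2 \<in> T" using leaf by auto
      then have "overdominated ?V E T 1"
        using overI[OF TV, of "r + 1" "r + 2"] by (auto simp: covers)
      then show ?thesis
        using one_le_CR_set[of ?V 1 E T] large[of "r + 1" "r + 2"] \<open>r + 1 \<in> T\<close> \<open>r + 2 \<in> T\<close> rest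
        by simp
    qed
  qed
  have "CR ?V E = 1" "gamma_CR ?V E = r"
    using CR_one_gamma_CR_eqI[OF _ dom CR_set bound] by simp_all
  then show ?thesis
    unfolding gamma_CR_values_def using simple card_E
    by (intro CollectI exI[of _ ?V] exI[of _ E]) auto
qed

section \<open>The maximal value\<close>

lemma choose_two_Suc: "Suc k choose 2 = (k choose 2) + k"
  by (simp add: numeral_2_eq_2)

lemma choose_two_pred:
  assumes "2 \<le> n"
  shows "(n - 1) choose 2 = ((n - 2) choose 2) + (n - 2)"
proof -
  have "n - 1 = Suc (n - 2)" using assms by simp
  then show ?thesis using choose_two_Suc by metis
qed

theorem theorem4p4:
  fixes n m :: nat
  assumes "5 \<le> n" and "4 \<le> m" and "m \<le> n choose 2"
  shows "(m \<le> n + 1 \<longrightarrow> D n 1 m = n - 3) \<and>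
    (\<forall>r::nat. n + 2 \<le> m \<and> m \<le> (n - 1) choose 2 \<and> 1 \<le> r \<and> r \<le> n \<and>
        ((n - (r + 1)) choose 2) + (n - 2) < m \<and> m \<le> ((n - r) choose 2) + (n - 2)
        \<longrightarrow> D n 1 m = r) \<and>
    ((n - 1) choose 2 < m \<longrightarrow> D n 1 m = 0)"
proof (intro conjI allI impI)
  assume m: "m \<le> n + 1"
  define r where "r = n - 3"
  have n: "n = r + 3" "2 \<le> r" using assms(1) by (auto simp: r_def)
  have "r \<in> gamma_CR_values n 1 m"
  proof -
    consider "m = 4" | "m = 5" | "6 \<le> m" using assms(2) by linarith
    then show ?thesis
    \<comment> \<open>From five edges on, the clique is a single edge; unused vertices are isolated.\<close>
    proof cases
      case 1
      then show ?thesis using spider_value n by simp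
    next
      case 2
      then show ?thesis using hub_graph_value[of 2 2 r 0] n by (simp add: numeral_eq_Suc)
    next
      case 3
      have "r \<in> gamma_CR_values (r + 2 + 1) 1 ((2 choose 2) + 2 + (m - 4) + 1)"
        by (rule hub_graph_value) (use 3 n m in auto)
      moreover have "r + 2 + 1 = n" "(2 choose 2) + 2 + (m - 4) + 1 = m"
        using 3 n by auto
      ultimately show ?thesis by metis
    qed
  qed
  moreover have "g \<le> r" if "g \<in> gamma_CR_values n 1 m" for g
    using gamma_CR_valueD(3)[OF that assms(2)] by (simp add: r_def)
  moreover have "1 \<le> n" using assms(1) by simp
  ultimately show "D n 1 m = n - 3"
    using D_eqI r_def by blast
next
  fix r
  assume *: "n + 2 \<le> m \<and> m \<le> (n - 1) choose 2 \<and> 1 \<le> r \<and> r \<le> n \<and>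
    ((n - (r + 1)) choose 2) + (n - 2) < m \<and> m \<le> ((n - r) choose 2) + (n - 2)"
  have "r + 4 \<le> n"
  proof (rule ccontr)
    assume "\<not> r + 4 \<le> n"
    then have "(n - r) choose 2 \<le> 3 choose 2"
      by (intro binomial_right_mono) simp
    moreover have "3 choose 2 = (3::nat)" by (simp add: numeral_eq_Suc)
    ultimately show False using * assms(1) by linarith
  qed
  have "r \<noteq> 1"
  proof
    assume "r = 1"
    then have "r + 1 = 2" by simp
    then have "((n - 2) choose 2) + (n - 2) < m" using * by metis
    moreover have "(n - 1) choose 2 = ((n - 2) choose 2) + (n - 2)"
      using choose_two_pred assms(1) by simp
    ultimately show False using * by linarith
  qed
  then have "2 \<le> r" using * by linarith
  define q where "q = n - (r + 1)"
  have n: "n = r + q + 1" "3 \<le> q" using \<open>r + 4 \<le> n\<close> by (auto simp: q_def)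
  \<comment> \<open>With a clique of size \<open>q\<close>, the hub must have degree \<open>t\<close>.\<close>
  define t where "t = m - (q choose 2) - q"
  have "n - r = Suc q" using n by simp
  then have t: "m = (q choose 2) + q + t" "r \<le> t" "t < r + q"
    using * n choose_two_Suc[of q] by (auto simp: t_def q_def[symmetric])
  have "r \<in> gamma_CR_values n 1 m"
  proof -
    \<comment> \<open>The hub needs a neighbour in the clique unless it has just two in \<open>S\<close>. So for \<open>t = r \<ge> 3\<close> one
      vertex of \<open>S\<close> is left isolated; for \<open>t > r\<close> the hub is joined to all of \<open>S\<close>.\<close>
    consider "t = r" "r = 2" | "t = r" "3 \<le> r" | "r < t" using t \<open>2 \<le> r\<close> by linarith
    then show ?thesis
    proof cases
      case 1
      then show ?thesis using hub_graph_value[of q 2 r 0] n t by simp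
    next
      case 2
      then show ?thesis using hub_graph_value[of q "r - 1" r 1] n t by simp
    next
      case 3
      then show ?thesis using hub_graph_value[of q r r "t - r"] n t \<open>2 \<le> r\<close>
        by (simp add: add.assoc)
    qed
  qed
  moreover have "g \<le> r" if "g \<in> gamma_CR_values n 1 m" for g
  proof (rule ccontr)
    assume "\<not> g \<le> r"
    then have "(n - g) choose 2 \<le> (n - (r + 1)) choose 2"
      by (intro binomial_right_mono) simp
    then show False using gamma_CR_valueD(2)[OF that] * by linarith
  qed
  ultimately show "D n 1 m = r"
    using assms(1) by (intro D_eqI) simp_all
next
  assume m: "(n - 1) choose 2 < m"
  have False if "g \<in> gamma_CR_values n 1 m" for g
  proof -
    have "(n - g) choose 2 \<le> (n - 2) choose 2"
      using gamma_CR_valueD(1)[OF that] by (intro binomial_right_mono) simp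
    moreover have "(n - 1) choose 2 = ((n - 2) choose 2) + (n - 2)"
      using choose_two_pred assms(1) by simp
    ultimately show False using gamma_CR_valueD(2)[OF that] m by linarith
  qed
  then show "D n 1 m = 0"
    unfolding D_def by auto
qed

end
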